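(* Let $X,Y\in\mathbb{C}^{n\times n}$ be both Hermitian positive semi-definite. Then $X+Y-4(X:Y)\ge 0$, and a common upper bound of $X$ and $Y$ is given by $$X\vee Y=\frac{X+Y}{2}+(X+Y)^{\frac12}\, W^{\frac12}\, (X+Y)^{\frac12},$$ where $$W=\Big[(X+Y)^\dagger\Big]^{\frac12}\Big[\frac{X+Y}{4}-X:Y\Big]\Big[(X+Y)^\dagger\Big]^{\frac12};$$ that is, $X\vee Y\ge X$ and $X\vee Y\ge Y$. Furthermore, $X\vee Y\le C_{X,Y}$, and $X\vee Y=C_{X,Y}$ if and only if $X:Y=0$, where $C_{X,Y}=X+Y-X:Y$.
   Context: $\mathbb{C}^{n\times n}$ is the set of $n\times n$ complex matrices. For Hermitian $B,C\in\mathbb{C}^{n\times n}$, $B\ge C$ (equivalently $C\le B$) means that $B-C$ is positive semi-definite. $M^\dagger$ denotes the Moore-Penrose inverse of $M$, i.e. the unique matrix satisfying $MM^\dagger M=M$, $M^\dagger MM^\dagger=M^\dagger$, $(MM^\dagger)^*=MM^\dagger$, $(M^\dagger M)^*=M^\dagger M$. For a Hermitian positive semi-definite $M$, $M^{\frac12}$ is its positive semi-definite square root (and $M^\dagger$ is again positive semi-definite). The parallel sum of Hermitian positive semi-definite matrices $A,B\in\mathbb{C}^{n\times n}$ is $A:B=A(A+B)^\dagger B$, which is Hermitian positive semi-definite. The first assertion of the claim guarantees that $W\ge 0$, so that $W^{\frac12}$ is well defined. *)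

theory Defs
  imports "Jordan_Normal_Form.Schur_Decomposition"
begin

(* Equality of matrices includes equality of dimensions, so a Hermitian matrix is square. *)
definition hermitian_mat :: "complex mat \<Rightarrow> bool" where
  "hermitian_mat A \<longleftrightarrow> mat_adjoint A = A"

(* The scalar product \<bullet>c conjugates its second argument: (A v) \<bullet>c v is v^* A v,
   which is real because A is Hermitian. *)
definition psd_mat :: "complex mat \<Rightarrow> bool" where
  "psd_mat A \<longleftrightarrow> hermitian_mat A \<and>
     (\<forall>v \<in> carrier_vec (dim_row A). 0 \<le> Re ((A *\<^sub>v v) \<bullet>c v))"

definition loewner_le :: "complex mat \<Rightarrow> complex mat \<Rightarrow> bool" (infix \<open>\<le>\<^sub>L\<close> 50) where
  "C \<le>\<^sub>L B \<longleftrightarrow> dim_row C = dim_row B \<and> hermitian_mat C \<and> hermitian_mat B \<and> psd_mat (B - C)"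

definition mp_inverse :: "complex mat \<Rightarrow> complex mat" where
  "mp_inverse M = (THE P. P \<in> carrier_mat (dim_col M) (dim_row M) \<and>
     M * P * M = M \<and> P * M * P = P \<and>
     mat_adjoint (M * P) = M * P \<and> mat_adjoint (P * M) = P * M)"

(* Meaningful for positive semi-definite M only. *)
definition psd_sqrt :: "complex mat \<Rightarrow> complex mat" where
  "psd_sqrt M = (THE R. psd_mat R \<and> R * R = M)"

definition parallel_sum :: "complex mat \<Rightarrow> complex mat \<Rightarrow> complex mat" where
  "parallel_sum A B = A * mp_inverse (A + B) * B"

definition join_W :: "complex mat \<Rightarrow> complex mat \<Rightarrow> complex mat" where
  "join_W X Y = psd_sqrt (mp_inverse (X + Y)) *
     ((1/4) \<cdot>\<^sub>m (X + Y) - parallel_sum X Y) * psd_sqrt (mp_inverse (X + Y))"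

definition mat_join :: "complex mat \<Rightarrow> complex mat \<Rightarrow> complex mat" where
  "mat_join X Y = (1/2) \<cdot>\<^sub>m (X + Y) +
     psd_sqrt (X + Y) * psd_sqrt (join_W X Y) * psd_sqrt (X + Y)"

definition upper_C :: "complex mat \<Rightarrow> complex mat \<Rightarrow> complex mat" where
  "upper_C X Y = X + Y - parallel_sum X Y"

end

theory Submission
  imports Defs
begin

text \<open>Put \<open>S = X + Y\<close>, \<open>D = X - Y\<close>, let \<open>T\<close>, \<open>K\<close> be the square roots of \<open>S\<close> and of its
  Moore-Penrose inverse \<open>S\<^sup>+\<close>, and let \<open>P = T K = K T\<close>. Since \<open>P\<close> fixes \<open>X\<close> and \<open>Y\<close>, one gets
  \<open>S - 4 (X : Y) = D S\<^sup>+ D \<ge> 0\<close>, hence \<open>W = F F\<close> with \<open>F = K D K / 2\<close>, and \<open>R = sqrt W\<close> is the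
  absolute value of \<open>F\<close>. As \<open>T F T = D / 2\<close>, the differences of the join with \<open>X\<close> and \<open>Y\<close> are
  \<open>T (R - F) T\<close> and \<open>T (R + F) T\<close>, both positive semi-definite. Finally \<open>P R = R\<close> turns the gap between
  the join and the upper bound \<open>S - X : Y\<close> into the Gram matrix \<open>T (P / 2 - R)\<^sup>2 T\<close>, which vanishes iff
  \<open>R = P / 2\<close>, iff \<open>W = P / 4\<close>, iff \<open>X : Y = T (P / 4 - W) T = 0\<close>.\<close>

section \<open>Matrix arithmetic and adjoints\<close>

text \<open>Products are normalised to right-nested form, which hides a known product of two
  neighbouring factors; this rule rewrites such a pair in front of a remaining factor
  \<open>Z\<close>.\<close>

lemma assoc_mult_eq:
  fixes A B C Z :: "complex mat"
  assumes "A * B = C" "A \<in> carrier_mat n n" "B \<in> carrier_mat n n" "Z \<in> carrier_mat n n"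
  shows "A * (B * Z) = C * Z"
  using assms by (metis assoc_mult_mat)

lemma smult_smult_mat: "a \<cdot>\<^sub>m (b \<cdot>\<^sub>m A) = (a * b) \<cdot>\<^sub>m (A :: complex mat)"
  by (rule eq_matI) auto

lemma mat_diff_eqI:
  fixes A B :: "complex mat"
  assumes "A + B = C" "A \<in> carrier_mat n n" "B \<in> carrier_mat n n"
  shows "A = C - B"
  unfolding assms(1)[symmetric] by (rule eq_matI) (use assms(2,3) in auto)

lemma mat_diff_eq_zeroD:
  fixes A B :: "complex mat"
  assumes "A - B = 0\<^sub>m n n" and A: "A \<in> carrier_mat n n" and B: "B \<in> carrier_mat n n"
  shows "A = B"
proof -
  have "A = (A - B) + B" using A B by (intro eq_matI) auto
  then show ?thesis using assms by simp
qed

lemma mat_adjoint_carrier [simp]: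
  "A \<in> carrier_mat nr nc \<Longrightarrow> mat_adjoint A \<in> carrier_mat nc nr"
  unfolding mat_adjoint_def by (auto simp: mat_of_rows_def)

lemma dim_mat_adjoint [simp]:
  "dim_row (mat_adjoint A) = dim_col A" "dim_col (mat_adjoint A) = dim_row A"
  unfolding mat_adjoint_def by (auto simp: mat_of_rows_def)

lemma index_mat_adjoint [simp]:
  assumes "i < dim_col A" "j < dim_row A"
  shows "mat_adjoint A $$ (i, j) = conjugate (A $$ (j, i))"
  using assms unfolding mat_adjoint_def by (auto simp: mat_of_rows_def)

lemma mat_adjoint_adjoint [simp]: "mat_adjoint (mat_adjoint A) = A"
  by (rule eq_matI) auto

lemma mat_adjoint_add:
  "A \<in> carrier_mat nr nc \<Longrightarrow> B \<in> carrier_mat nr nc \<Longrightarrow>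
    mat_adjoint (A + B) = mat_adjoint A + mat_adjoint B"
  by (rule eq_matI) (auto simp: conjugate_dist_add)

lemma mat_adjoint_minus:
  fixes A B :: "complex mat"
  shows "A \<in> carrier_mat nr nc \<Longrightarrow> B \<in> carrier_mat nr nc \<Longrightarrow>
    mat_adjoint (A - B) = mat_adjoint A - mat_adjoint B"
  by (rule eq_matI) auto

lemma mat_adjoint_smult:
  fixes A :: "complex mat"
  shows "mat_adjoint (k \<cdot>\<^sub>m A) = cnj k \<cdot>\<^sub>m mat_adjoint A"
  by (rule eq_matI) auto

lemma mat_adjoint_mult:
  fixes A B :: "complex mat"
  assumes "A \<in> carrier_mat nr n" "B \<in> carrier_mat n nc"
  shows "mat_adjoint (A * B) = mat_adjoint B * mat_adjoint A"
  by (rule eq_matI) (use assms in \<open>auto simp: scalar_prod_def intro!: sum.cong\<close>)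

lemma mat_adjoint_one [simp]: "mat_adjoint (1\<^sub>m n :: complex mat) = 1\<^sub>m n"
  by (rule eq_matI) auto

lemma mat_adjoint_zero [simp]: "mat_adjoint (0\<^sub>m nr nc :: complex mat) = 0\<^sub>m nc nr"
  by (rule eq_matI) auto

lemma mat_adjoint_four_block:
  fixes A B C D :: "complex mat"
  assumes "A \<in> carrier_mat nr1 nc1" "B \<in> carrier_mat nr1 nc2"
    "C \<in> carrier_mat nr2 nc1" "D \<in> carrier_mat nr2 nc2"
  shows "mat_adjoint (four_block_mat A B C D) =
    four_block_mat (mat_adjoint A) (mat_adjoint C) (mat_adjoint B) (mat_adjoint D)"
  by (rule eq_matI) (use assms in auto)

lemma mat_adjoint_scalar_prod:
  fixes A :: "complex mat"
  assumes "A \<in> carrier_mat nr nc" "v \<in> carrier_vec nc" "w \<in> carrier_vec nr"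
  shows "(A *\<^sub>v v) \<bullet>c w = v \<bullet>c (mat_adjoint A *\<^sub>v w)"
proof -
  have "(A *\<^sub>v v) \<bullet>c w = (\<Sum>i<nr. \<Sum>j<nc. A $$ (i, j) * v $ j * cnj (w $ i))"
    using assms by (auto simp: scalar_prod_def sum_distrib_right atLeast0LessThan)
  also have "\<dots> = (\<Sum>j<nc. \<Sum>i<nr. A $$ (i, j) * v $ j * cnj (w $ i))"
    by (rule sum.swap)
  also have "\<dots> = v \<bullet>c (mat_adjoint A *\<^sub>v w)"
    using assms
    by (auto simp: scalar_prod_def sum_distrib_left atLeast0LessThan intro!: sum.cong)
  finally show ?thesis .
qed

lemma hermitian_carrier:
  assumes "hermitian_mat A"
  shows "A \<in> carrier_mat (dim_row A) (dim_row A)"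
  using assms unfolding hermitian_mat_def by (metis carrier_matI dim_mat_adjoint(1))

section \<open>Spectral theorem\<close>

definition unitary_mat :: "nat \<Rightarrow> complex mat \<Rightarrow> bool" where
  "unitary_mat n U \<longleftrightarrow> U \<in> carrier_mat n n \<and> U * mat_adjoint U = 1\<^sub>m n \<and> mat_adjoint U * U = 1\<^sub>m n"

text \<open>A left inverse of a square matrix is also a right inverse, so one of the two identities
  suffices.\<close>

lemma unitary_matI:
  assumes U: "U \<in> carrier_mat n n" and "mat_adjoint U * U = 1\<^sub>m n"
  shows "unitary_mat n U"
  using mat_mult_left_right_inverse[OF mat_adjoint_carrier[OF U] U assms(2)] assms
  unfolding unitary_mat_def by auto

lemma unitary_mat_mult:
  assumes "unitary_mat n U" "unitary_mat n V"
  shows "unitary_mat n (U * V)"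
proof (rule unitary_matI)
  have c: "U \<in> carrier_mat n n" "V \<in> carrier_mat n n" and U: "mat_adjoint U * U = 1\<^sub>m n"
    and V: "mat_adjoint V * V = 1\<^sub>m n"
    using assms unfolding unitary_mat_def by auto
  show "U * V \<in> carrier_mat n n" using c by simp
  have "mat_adjoint (U * V) * (U * V) = mat_adjoint V * ((mat_adjoint U * U) * V)"
    using c by (simp add: mat_adjoint_mult[of _ n n _ n] assoc_mult_mat[of _ n n _ n _ n])
  then show "mat_adjoint (U * V) * (U * V) = 1\<^sub>m n"
    using c unfolding U by (simp add: V)
qed

text \<open>Used for deflation in the spectral theorem. The vector is completed to a basis,
  Gram-Schmidt makes the basis orthogonal while keeping its head, and the normalised vectors become
  the columns of \<open>W\<close>.\<close>

lemma unitary_completion: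
  fixes v :: "complex vec"
  assumes v: "v \<in> carrier_vec n" and v0: "v \<noteq> 0\<^sub>v n"
  obtains W c where "unitary_mat n W" "col W 0 = c \<cdot>\<^sub>v v"
proof -
  have n: "n \<noteq> 0" using v v0 by auto
  interpret cof_vec_space n "TYPE(complex)" .
  define b where "b = basis_completion v"
  define ws where "ws = gram_schmidt n b"
  from basis_completion[OF v v0, folded b_def]
  have dist_b: "distinct b" and indep: "\<not> lin_dep (set b)" and b: "set b \<subseteq> carrier_vec n"
    and hdb: "hd b = v" and len_b: "length b = n" by auto
  from hdb len_b n obtain vs where bv: "b = v # vs" by (cases b) auto
  from gram_schmidt_result[OF b dist_b indep refl, folded ws_def]
  have ws: "set ws \<subseteq> carrier_vec n" "corthogonal ws" "length ws = n"
    by (auto simp: len_b)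
  from gram_schmidt_hd[OF v, of vs, folded bv] have hdws: "hd ws = v" unfolding ws_def .
  have ws0: "ws ! 0 = v" using hdws ws(3) n by (cases ws) auto
  have wc: "ws ! i \<in> carrier_vec n" if "i < n" for i
    using ws that by auto
  \<comment> \<open>Gram-Schmidt yields orthogonal vectors of arbitrary length; \<open>r i\<close>
    is the reciprocal of the norm of the vector with index \<open>i\<close>.\<close>
  define r where "r i = complex_of_real (1 / sqrt (Re (ws ! i \<bullet>c ws ! i)))" for i
  define W where "W = mat n n (\<lambda>(i, j). r j * ws ! j $ i)"
  have W: "W \<in> carrier_mat n n" unfolding W_def by simp
  have "mat_adjoint W * W = 1\<^sub>m n"
  proof (rule eq_matI)
    fix i j assume ij: "i < dim_row (1\<^sub>m n :: complex mat)" "j < dim_col (1\<^sub>m n :: complex mat)"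
    have wi: "ws ! i \<in> carrier_vec n" and wj: "ws ! j \<in> carrier_vec n" using ij wc by auto
    have "(mat_adjoint W * W) $$ (i, j) = (\<Sum>k = 0..<n. cnj (r i * ws ! i $ k) * (r j * ws ! j $ k))"
      using ij unfolding W_def by (simp add: scalar_prod_def)
    also have "\<dots> = r i * r j * (ws ! j \<bullet>c ws ! i)"
      using wi wj by (auto simp: scalar_prod_def sum_distrib_left r_def intro!: sum.cong)
    also have "\<dots> = 1\<^sub>m n $$ (i, j)"
    proof (cases "i = j")
      case True
      \<comment> \<open>\<open>corthogonal\<close> makes a product vanish exactly when the two
        indices differ, so the squared norm is nonzero, and it is non-negative anyway.\<close>
      have pos: "ws ! i \<bullet>c ws ! i > 0"
        using corthogonalD[OF ws(2), of i i] ij ws(3) conjugate_square_ge_0_vec[of "ws ! i"]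
        by (simp add: order.strict_iff_order)
      then have re: "Re (ws ! i \<bullet>c ws ! i) > 0" and im: "Im (ws ! i \<bullet>c ws ! i) = 0"
        by (auto simp: less_complex_def)
      have "ws ! i \<bullet>c ws ! i = of_real (Re (ws ! i \<bullet>c ws ! i))"
        using im by (simp add: complex_eq_iff)
      moreover have "r i * r i = of_real (1 / Re (ws ! i \<bullet>c ws ! i))"
        unfolding r_def of_real_mult[symmetric] using re by simp
      ultimately have "r i * r i * (ws ! i \<bullet>c ws ! i)
          = of_real (1 / Re (ws ! i \<bullet>c ws ! i) * Re (ws ! i \<bullet>c ws ! i))"
        by (metis of_real_mult)
      then show ?thesis using re True ij by simp
    next
      case False
      then have "ws ! j \<bullet>c ws ! i = 0"
        using corthogonalD[OF ws(2), of j i] ij ws(3) by simp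
      then show ?thesis using ij False by simp
    qed
    finally show "(mat_adjoint W * W) $$ (i, j) = 1\<^sub>m n $$ (i, j)" .
  qed (use W in auto)
  from unitary_matI[OF W this] have "unitary_mat n W" .
  moreover have "col W 0 = r 0 \<cdot>\<^sub>v v"
    using ws0 ws(3) n v unfolding W_def
    by (intro eq_vecI) auto
  ultimately show ?thesis by (rule that)
qed

text \<open>Functional calculus in a fixed eigenbasis: if \<open>A = spectral_mat n U d\<close>,
  then square root, absolute value and Moore-Penrose inverse of \<open>A\<close> arise by changing
  the real function only. Its values at indices from \<open>n\<close> on have no influence.\<close>

definition spectral_mat :: "nat \<Rightarrow> complex mat \<Rightarrow> (nat \<Rightarrow> real) \<Rightarrow> complex mat" where
  "spectral_mat n U f = U * mat_diag n (\<lambda>i. of_real (f i)) * mat_adjoint U"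

text \<open>Induction on the dimension by deflation. In a unitary basis starting with an
  eigenvector, the first column of the matrix vanishes below the corner; being Hermitian, it has a
  vanishing rest of the first row as well, and the induction hypothesis diagonalises the remaining
  block.\<close>

lemma hermitian_spectral:
  assumes "A \<in> carrier_mat n n" "hermitian_mat A"
  obtains U d where "unitary_mat n U" "A = spectral_mat n U d"
proof -
  have "\<exists>U (d :: nat \<Rightarrow> real). unitary_mat n U \<and> A = U * mat_diag n (\<lambda>i. of_real (d i)) * mat_adjoint U"
    using assms
  proof (induct n arbitrary: A)
    case 0
    then show ?case
      by (intro exI[of _ "1\<^sub>m 0"] exI[of _ "\<lambda>_. 0"]) (auto simp: unitary_mat_def intro!: eq_matI)
  next
    case (Suc n A)
    let ?m = "Suc n"
    have A: "A \<in> carrier_mat ?m ?m" and hA: "mat_adjoint A = A"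
      using Suc.prems by (auto simp: hermitian_mat_def)
    \<comment> \<open>Over the complex numbers the characteristic polynomial splits into
      \<open>Suc n\<close> linear factors, so at least one root exists.\<close>
    from char_poly_factorized[OF A] obtain as where
      as: "char_poly A = (\<Prod>a\<leftarrow>as. [:- a, 1:])" "length as = ?m" by blast
    then obtain e es where "as = e # es" by (cases as) auto
    then have "eigenvalue A e" unfolding eigenvalue_root_char_poly[OF A] as(1) by simp
    then obtain v where v: "v \<in> carrier_vec ?m" "v \<noteq> 0\<^sub>v ?m" "A *\<^sub>v v = e \<cdot>\<^sub>v v"
      using A unfolding eigenvalue_def eigenvector_def by auto
    from unitary_completion[OF v(1,2)] obtain W c where W: "unitary_mat ?m W" "col W 0 = c \<cdot>\<^sub>v v" .
    have Wc: "W \<in> carrier_mat ?m ?m" and WW: "W * mat_adjoint W = 1\<^sub>m ?m" "mat_adjoint W * W = 1\<^sub>m ?m"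
      using W unfolding unitary_mat_def by auto
    define B where "B = mat_adjoint W * (A * W)"
    have B: "B \<in> carrier_mat ?m ?m" unfolding B_def using A Wc by auto
    have hB: "mat_adjoint B = B"
      unfolding B_def using A Wc hA
      by (simp add: mat_adjoint_mult[of _ ?m ?m _ ?m] assoc_mult_mat[of _ ?m ?m _ ?m _ ?m] mult_carrier_mat[of _ ?m ?m _ ?m])
    have "W * B * mat_adjoint W = (W * mat_adjoint W) * A * (W * mat_adjoint W)"
      unfolding B_def using A Wc by (simp add: assoc_mult_mat[of _ ?m ?m _ ?m _ ?m] mult_carrier_mat[of _ ?m ?m _ ?m])
    then have AB: "A = W * B * mat_adjoint W" unfolding WW using A by simp
    \<comment> \<open>The first column of \<open>W\<close> is a multiple of \<open>v\<close>, hence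
      satisfies the same eigenvalue equation whatever the factor \<open>c\<close> is.\<close>
    have "col (A * W) 0 = A *\<^sub>v col W 0" using A Wc by auto
    also have "\<dots> = e \<cdot>\<^sub>v col W 0" unfolding W(2) mult_mat_vec[OF A v(1)] v(3)
      by (simp add: smult_smult_assoc mult.commute)
    finally have cAW: "col (A * W) 0 = e \<cdot>\<^sub>v col W 0" .
    have B0: "B $$ (i, 0) = (if i = 0 then e else 0)" if i: "i < ?m" for i
    proof -
      have "B $$ (i, 0) = row (mat_adjoint W) i \<bullet> col (A * W) 0"
        unfolding B_def using i A Wc by auto
      also have "\<dots> = e * (mat_adjoint W * W) $$ (i, 0)"
        unfolding cAW using i Wc by auto
      finally show ?thesis unfolding WW using i by simp
    qed
    have B0': "B $$ (0, i) = (if i = 0 then cnj e else 0)" if i: "i < ?m" for i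
    proof -
      have "B $$ (0, i) = mat_adjoint B $$ (0, i)" unfolding hB ..
      also have "\<dots> = cnj (B $$ (i, 0))" using i B by simp
      finally show ?thesis using B0[OF i] by auto
    qed
    \<comment> \<open>The corner entry of the Hermitian \<open>B\<close> equals its own conjugate,
      so the eigenvalue is real.\<close>
    obtain r where e: "e = of_real r"
      using B0[of 0] B0'[of 0] by (metis Reals_cases Reals_cnj_iff zero_less_Suc)
    define A3 where "A3 = mat n n (\<lambda>(i, j). B $$ (Suc i, Suc j))"
    have A3: "A3 \<in> carrier_mat n n" unfolding A3_def by simp
    have "mat_adjoint A3 = A3"
    proof (rule eq_matI)
      fix i j assume ij: "i < dim_row A3" "j < dim_col A3"
      then have ij': "i < n" "j < n" using A3 by auto
      have "mat_adjoint A3 $$ (i, j) = mat_adjoint B $$ (Suc i, Suc j)"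
        using ij' B A3 unfolding A3_def by simp
      then show "mat_adjoint A3 $$ (i, j) = A3 $$ (i, j)"
        unfolding hB using ij' by (simp add: A3_def)
    qed (use A3 in auto)
    with Suc.hyps[OF A3] obtain U and d :: "nat \<Rightarrow> real" where U: "unitary_mat n U"
      and A3U: "A3 = U * mat_diag n (\<lambda>i. of_real (d i)) * mat_adjoint U"
      unfolding hermitian_mat_def by blast
    have Uc: "U \<in> carrier_mat n n" and UU: "mat_adjoint U * U = 1\<^sub>m n"
      using U unfolding unitary_mat_def by auto
    let ?blk = "\<lambda>a M. four_block_mat (a \<cdot>\<^sub>m 1\<^sub>m 1) (0\<^sub>m 1 n) (0\<^sub>m n 1) M"
    have Bblk: "B = ?blk e A3"
    proof (rule eq_matI)
      fix i j assume "i < dim_row (?blk e A3)" "j < dim_col (?blk e A3)"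
      then have ij: "i < ?m" "j < ?m" using A3 by auto
      show "B $$ (i, j) = ?blk e A3 $$ (i, j)"
        using ij A3 B0 B0'[of j] by (cases i; cases j) (auto simp: A3_def)
    qed (use B A3 in auto)
    define d' where "d' i = (case i of 0 \<Rightarrow> r | Suc k \<Rightarrow> d k)" for i
    let ?D = "mat_diag n (\<lambda>i. of_real (d i))"
    have Dblk: "mat_diag ?m (\<lambda>i. of_real (d' i)) = ?blk e ?D"
    proof (rule eq_matI)
      fix i j assume "i < dim_row (?blk e ?D)" "j < dim_col (?blk e ?D)"
      then have ij: "i < ?m" "j < ?m" by (auto simp: mat_diag_def)
      show "mat_diag ?m (\<lambda>i. of_real (d' i)) $$ (i, j) = ?blk e ?D $$ (i, j)"
        using ij e by (cases i; cases j) (auto simp: mat_diag_def d'_def)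
    qed (auto simp: mat_diag_def)
    \<comment> \<open>The diagonalisation of the small block is extended by a fixed first basis
      vector.\<close>
    define V where "V = ?blk 1 U"
    have V: "V \<in> carrier_mat ?m ?m" unfolding V_def by (rule carrier_matI) (use Uc in auto)
    have blk_mult: "?blk a M * ?blk b N = ?blk (a * b) (M * N)"
      if "M \<in> carrier_mat n n" "N \<in> carrier_mat n n" for a b :: complex and M N
      using that by (subst mult_four_block_mat[of _ 1 1 _ n _ n _ _ 1 _ n]) auto
    have aV: "mat_adjoint V = ?blk 1 (mat_adjoint U)"
      unfolding V_def using Uc
      by (subst mat_adjoint_four_block[of _ 1 1 _ n _ n]) (auto simp: mat_adjoint_smult)
    have "mat_adjoint V * V = ?blk 1 (1\<^sub>m n)"
      unfolding aV unfolding V_def using Uc by (subst blk_mult) (auto simp: UU)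
    also have "\<dots> = 1\<^sub>m ?m" by (rule eq_matI) auto
    finally have uV: "unitary_mat ?m V" by (rule unitary_matI[OF V])
    have "V * mat_diag ?m (\<lambda>i. of_real (d' i)) * mat_adjoint V = ?blk e (U * ?D * mat_adjoint U)"
      unfolding aV Dblk unfolding V_def using Uc by (simp add: blk_mult del: One_nat_def)
    then have "B = V * mat_diag ?m (\<lambda>i. of_real (d' i)) * mat_adjoint V"
      unfolding Bblk A3U ..
    then have "A = (W * V) * mat_diag ?m (\<lambda>i. of_real (d' i)) * mat_adjoint (W * V)"
      using AB Wc V
      by (simp add: mat_adjoint_mult[of _ ?m ?m _ ?m] assoc_mult_mat[of _ ?m ?m _ ?m _ ?m] mult_carrier_mat[of _ ?m ?m _ ?m])
    then show ?case using unitary_mat_mult[OF W(1) uV] by blast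
  qed
  then show ?thesis using that unfolding spectral_mat_def by blast
qed

section \<open>Positive semi-definite matrices\<close>

lemma hermitian_mat_diag: "mat_adjoint (mat_diag n (\<lambda>i. complex_of_real (f i))) = mat_diag n (\<lambda>i. of_real (f i))"
  by (rule eq_matI) (auto simp: mat_diag_def)

lemma mat_adjoint_conj:
  fixes A B :: "complex mat"
  assumes "A \<in> carrier_mat n n" "B \<in> carrier_mat n n"
  shows "mat_adjoint (B * A * mat_adjoint B) = B * mat_adjoint A * mat_adjoint B"
  using assms
  by (simp add: mat_adjoint_mult[of _ n n _ n] assoc_mult_mat[of _ n n _ n _ n] mult_carrier_mat[of _ n n _ n])

text \<open>Moving \<open>B\<close> across the scalar product turns the quadratic form at
  \<open>v\<close> into that of \<open>A\<close> at the image of \<open>v\<close> under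
  \<open>mat_adjoint B\<close>.\<close>

lemma psd_mat_conj:
  assumes A: "A \<in> carrier_mat n n" "psd_mat A" and B: "B \<in> carrier_mat n n"
  shows "psd_mat (B * A * mat_adjoint B)"
  unfolding psd_mat_def
proof (intro conjI ballI)
  show "hermitian_mat (B * A * mat_adjoint B)"
    using mat_adjoint_conj[OF A(1) B] A(2) unfolding hermitian_mat_def psd_mat_def by simp
  fix v :: "complex vec" assume "v \<in> carrier_vec (dim_row (B * A * mat_adjoint B))"
  then have v: "v \<in> carrier_vec n" using B by simp
  let ?w = "mat_adjoint B *\<^sub>v v"
  have B': "mat_adjoint B \<in> carrier_mat n n" using B by simp
  then have w: "?w \<in> carrier_vec n" using v by simp
  have "(B * A * mat_adjoint B) *\<^sub>v v = B *\<^sub>v (A *\<^sub>v ?w)"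
    using A(1) B B' v w by (simp add: assoc_mult_mat_vec[of _ n n _ n])
  then have "((B * A * mat_adjoint B) *\<^sub>v v) \<bullet>c v = (A *\<^sub>v ?w) \<bullet>c ?w"
    using mat_adjoint_scalar_prod[OF B _ v, of "A *\<^sub>v ?w"] A(1) w by simp
  then show "0 \<le> Re (((B * A * mat_adjoint B) *\<^sub>v v) \<bullet>c v)"
    using A w unfolding psd_mat_def by auto
qed

lemma psd_mat_diag:
  assumes "\<And>i. 0 \<le> f i"
  shows "psd_mat (mat_diag n (\<lambda>i. of_real (f i)))"
  unfolding psd_mat_def hermitian_mat_def
proof (intro conjI ballI)
  fix v :: "complex vec" assume "v \<in> carrier_vec (dim_row (mat_diag n (\<lambda>i. complex_of_real (f i))))"
  then have v: "v \<in> carrier_vec n" by (simp add: mat_diag_def)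
  have "(mat_diag n (\<lambda>i. complex_of_real (f i)) *\<^sub>v v) \<bullet>c v = (\<Sum>i = 0..<n. of_real (f i) * v $ i * cnj (v $ i))"
    using v by (auto simp: mat_diag_def scalar_prod_def if_distrib[of "\<lambda>x. x * _"] cong: if_cong)
  also have "\<dots> = of_real (\<Sum>i = 0..<n. f i * (cmod (v $ i))\<^sup>2)"
    by (simp add: mult.assoc complex_norm_square del: of_real_power)
  finally show "0 \<le> Re ((mat_diag n (\<lambda>i. complex_of_real (f i)) *\<^sub>v v) \<bullet>c v)"
    using assms by (simp add: sum_nonneg)
qed (rule hermitian_mat_diag)

lemma psd_mat_add:
  assumes "A \<in> carrier_mat n n" "psd_mat A" "B \<in> carrier_mat n n" "psd_mat B"
  shows "psd_mat (A + B)"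
  unfolding psd_mat_def
proof (intro conjI ballI)
  show "hermitian_mat (A + B)"
    using assms mat_adjoint_add[of A n n B] by (simp add: psd_mat_def hermitian_mat_def)
  fix v :: "complex vec" assume "v \<in> carrier_vec (dim_row (A + B))"
  then have v: "v \<in> carrier_vec n" using assms by simp
  then have "((A + B) *\<^sub>v v) \<bullet>c v = (A *\<^sub>v v) \<bullet>c v + (B *\<^sub>v v) \<bullet>c v"
    using assms by (simp add: add_mult_distrib_mat_vec[of _ n n] add_scalar_prod_distrib[of _ n])
  then show "0 \<le> Re (((A + B) *\<^sub>v v) \<bullet>c v)"
    using assms v by (simp add: psd_mat_def)
qed

lemma mat_adjoint_psd: "psd_mat A \<Longrightarrow> mat_adjoint A = A"
  by (simp add: psd_mat_def hermitian_mat_def)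

lemma psd_mat_smult:
  assumes A: "A \<in> carrier_mat n n" "psd_mat A" and k: "0 \<le> k"
  shows "psd_mat (complex_of_real k \<cdot>\<^sub>m A)"
  unfolding psd_mat_def
proof (intro conjI ballI)
  show "hermitian_mat (complex_of_real k \<cdot>\<^sub>m A)"
    using A mat_adjoint_psd[OF A(2)] by (simp add: hermitian_mat_def mat_adjoint_smult)
  fix v :: "complex vec" assume "v \<in> carrier_vec (dim_row (complex_of_real k \<cdot>\<^sub>m A))"
  then have v: "v \<in> carrier_vec n" using A by simp
  have "(complex_of_real k \<cdot>\<^sub>m A) *\<^sub>v v = complex_of_real k \<cdot>\<^sub>v (A *\<^sub>v v)"
    using A v by (intro eq_vecI) auto
  then have "((complex_of_real k \<cdot>\<^sub>m A) *\<^sub>v v) \<bullet>c v = complex_of_real k * ((A *\<^sub>v v) \<bullet>c v)"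
    using A v by simp
  then show "0 \<le> Re (((complex_of_real k \<cdot>\<^sub>m A) *\<^sub>v v) \<bullet>c v)"
    using A v k unfolding psd_mat_def by simp
qed

text \<open>Conjugation of the identity, taken as a diagonal matrix of ones. Both the first
  assertion of the theorem and the upper estimate of the join come down to a Gram matrix.\<close>

lemma psd_mat_gram:
  assumes "C \<in> carrier_mat n n"
  shows "psd_mat (mat_adjoint C * C)"
  using psd_mat_conj[of "1\<^sub>m n" n "mat_adjoint C"] psd_mat_diag[of "\<lambda>_. 1" n] assms by simp

text \<open>The diagonal entry is the value of the quadratic form at a unit vector.\<close>

lemma psd_mat_diag_entry:
  assumes A: "A \<in> carrier_mat n n" "psd_mat A" and i: "i < n"
  shows "0 \<le> Re (A $$ (i, i))"
proof -
  have "(A *\<^sub>v unit_vec n i) \<bullet>c unit_vec n i = A $$ (i, i)"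
    using A(1) i by (simp add: scalar_prod_def unit_vec_def if_distrib[of "\<lambda>x. _ * x"]
        if_distrib[of cnj] cong: if_cong)
  then show ?thesis using A i unfolding psd_mat_def by (metis carrier_matD(1) unit_vec_carrier)
qed

text \<open>The diagonal entry of the Gram matrix at \<open>j\<close> is the sum of the squared
  moduli in column \<open>j\<close> of \<open>C\<close>.\<close>

lemma gram_eq_zero:
  fixes C :: "complex mat"
  assumes C: "C \<in> carrier_mat n n" and 0: "mat_adjoint C * C = 0\<^sub>m n n"
  shows "C = 0\<^sub>m n n"
proof (rule eq_matI)
  fix i j assume "i < dim_row (0\<^sub>m n n :: complex mat)" "j < dim_col (0\<^sub>m n n :: complex mat)"
  then have ij: "i < n" "j < n" by auto
  have "of_real (\<Sum>k = 0..<n. (cmod (C $$ (k, j)))\<^sup>2) = (mat_adjoint C * C) $$ (j, j)"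
    using C ij by (simp add: scalar_prod_def complex_norm_square mult.commute del: of_real_power)
  then have "(\<Sum>k = 0..<n. (cmod (C $$ (k, j)))\<^sup>2) = 0" using ij by (simp add: 0 del: of_real_sum of_real_power)
  then have "(cmod (C $$ (i, j)))\<^sup>2 = 0"
    using sum_nonneg_eq_0_iff[of "{0..<n}" "\<lambda>k. (cmod (C $$ (k, j)))\<^sup>2"] ij by simp
  then show "C $$ (i, j) = 0\<^sub>m n n $$ (i, j)" using ij by simp
qed (use C in auto)

section \<open>Functional calculus in a unitary eigenbasis\<close>

context
  fixes n :: nat and U :: "complex mat"
  assumes U: "unitary_mat n U"
begin

lemma unitary_carrier: "U \<in> carrier_mat n n"
  using U unfolding unitary_mat_def by simp

lemma spectral_mat_carrier: "spectral_mat n U f \<in> carrier_mat n n"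
  unfolding spectral_mat_def using unitary_carrier by (intro mult_carrier_mat) auto

lemma hermitian_spectral_mat: "mat_adjoint (spectral_mat n U f) = spectral_mat n U f"
  unfolding spectral_mat_def using mat_adjoint_conj[OF _ unitary_carrier] hermitian_mat_diag by simp

lemma spectral_mat_mult: "spectral_mat n U f * spectral_mat n U g = spectral_mat n U (\<lambda>i. f i * g i)"
proof -
  let ?D = "\<lambda>f. mat_diag n (\<lambda>i. complex_of_real (f i))"
  have "spectral_mat n U f * spectral_mat n U g = U * (?D f * ((mat_adjoint U * U) * (?D g * mat_adjoint U)))"
    unfolding spectral_mat_def using unitary_carrier
    by (simp add: assoc_mult_mat[of _ n n _ n _ n] mult_carrier_mat[of _ n n _ n])
  also have "\<dots> = U * ((?D f * ?D g) * mat_adjoint U)"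
    using U unitary_carrier unfolding unitary_mat_def
    by (simp add: assoc_mult_mat[of _ n n _ n _ n] mult_carrier_mat[of _ n n _ n]
        left_mult_one_mat[of _ n n] del: mat_diag_diag)
  finally show ?thesis
    using unitary_carrier unfolding spectral_mat_def
    by (simp add: assoc_mult_mat[of _ n n _ n _ n] mult_carrier_mat[of _ n n _ n])
qed

lemma spectral_mat_add: "spectral_mat n U f + spectral_mat n U g = spectral_mat n U (\<lambda>i. f i + g i)"
proof -
  have "mat_diag n (\<lambda>i. complex_of_real (f i + g i)) =
      mat_diag n (\<lambda>i. of_real (f i)) + mat_diag n (\<lambda>i. of_real (g i))"
    by (rule eq_matI) (auto simp: mat_diag_def)
  then show ?thesis
    unfolding spectral_mat_def using unitary_carrier
    by (simp add: mult_add_distrib_mat[of _ n n _ n] add_mult_distrib_mat[of _ n n _ _ n] mult_carrier_mat[of _ n n _ n])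
qed

lemma spectral_mat_minus: "spectral_mat n U f - spectral_mat n U g = spectral_mat n U (\<lambda>i. f i - g i)"
proof -
  have "spectral_mat n U f = spectral_mat n U (\<lambda>i. f i - g i) + spectral_mat n U g"
    by (simp add: spectral_mat_add)
  then show ?thesis
    using spectral_mat_carrier[of "\<lambda>i. f i - g i"] spectral_mat_carrier[of g]
    by (simp only:) (auto intro!: eq_matI)
qed

lemma psd_spectral_mat:
  assumes "\<And>i. 0 \<le> f i"
  shows "psd_mat (spectral_mat n U f)"
  unfolding spectral_mat_def by (rule psd_mat_conj[OF _ psd_mat_diag[OF assms] unitary_carrier]) simp

text \<open>Passage to the eigenbasis, where single eigenvalues can be read off as diagonal
  entries.\<close>

lemma adjoint_conj_spectral_mat:
  "mat_adjoint U * spectral_mat n U f * U = mat_diag n (\<lambda>i. of_real (f i))"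
proof -
  let ?D = "mat_diag n (\<lambda>i. complex_of_real (f i))"
  have "mat_adjoint U * spectral_mat n U f * U = (mat_adjoint U * U) * (?D * (mat_adjoint U * U))"
    unfolding spectral_mat_def using unitary_carrier
    by (simp add: assoc_mult_mat[of _ n n _ n _ n] mult_carrier_mat[of _ n n _ n])
  then show ?thesis using U unfolding unitary_mat_def
    by (simp add: left_mult_one_mat[of _ n n] right_mult_one_mat[of _ n n])
qed

end

lemma psd_spectral:
  assumes A: "A \<in> carrier_mat n n" and psd: "psd_mat A"
  obtains U d where "unitary_mat n U" "A = spectral_mat n U d" "\<And>i. 0 \<le> d i"
proof -
  have "hermitian_mat A" using psd unfolding psd_mat_def by simp
  from hermitian_spectral[OF A this] obtain U d where
    U: "unitary_mat n U" and Ad: "A = spectral_mat n U d" .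
  have Uc: "mat_adjoint U \<in> carrier_mat n n" using unitary_carrier[OF U] by simp
  have "0 \<le> d i" if "i < n" for i
    using psd_mat_diag_entry[OF _ psd_mat_conj[OF A psd Uc] that]
      adjoint_conj_spectral_mat[OF U, of d] that A Uc unitary_carrier[OF U] unfolding Ad
    by (simp add: mat_diag_def mult_carrier_mat[of _ n n _ n])
  \<comment> \<open>The sign of \<open>d i\<close> is known for \<open>i < n\<close> only;
    truncation at 0 changes nothing there and gives non-negativity at every index.\<close>
  then have "mat_diag n (\<lambda>i. complex_of_real (d i)) = mat_diag n (\<lambda>i. of_real (max 0 (d i)))"
    by (intro eq_matI) (auto simp: mat_diag_def)
  then have "A = spectral_mat n U (\<lambda>i. max 0 (d i))" using Ad unfolding spectral_mat_def by simp
  with U show ?thesis by (intro that[of U "\<lambda>i. max 0 (d i)"]) auto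
qed

text \<open>In an eigenbasis of \<open>A\<close> each diagonal entry of the sum is an eigenvalue of
  \<open>A\<close> plus a diagonal entry of the transformed \<open>B\<close>. Both are non-negative,
  so all eigenvalues of \<open>A\<close> vanish.\<close>

lemma psd_sum_eq_zero:
  assumes A: "A \<in> carrier_mat n n" "psd_mat A" and B: "B \<in> carrier_mat n n" "psd_mat B"
    and 0: "A + B = 0\<^sub>m n n"
  shows "A = 0\<^sub>m n n"
proof -
  obtain U d where U: "unitary_mat n U" and Ad: "A = spectral_mat n U d" and d: "\<And>i. 0 \<le> d i"
    using psd_spectral[OF A] by blast
  note Uc = unitary_carrier[OF U]
  have U'c: "mat_adjoint U \<in> carrier_mat n n" using Uc by simp
  have "mat_adjoint U * A * U + mat_adjoint U * B * U = mat_adjoint U * (A + B) * U"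
    using A(1) B(1) Uc
    by (simp add: mult_add_distrib_mat[of _ n n _ n] add_mult_distrib_mat[of _ n n _ _ n] mult_carrier_mat[of _ n n _ n])
  also have "\<dots> = 0\<^sub>m n n" unfolding 0 using Uc by (simp add: left_mult_zero_mat[of _ n n])
  finally have sum0: "mat_adjoint U * A * U + mat_adjoint U * B * U = 0\<^sub>m n n" .
  have "d i = 0" if i: "i < n" for i
  proof -
    have Bc: "mat_adjoint U * B * U \<in> carrier_mat n n" using U'c Uc B by (intro mult_carrier_mat)
    have "Re ((mat_adjoint U * A * U + mat_adjoint U * B * U) $$ (i, i)) = 0"
      unfolding sum0 using i by simp
    then have "d i + Re ((mat_adjoint U * B * U) $$ (i, i)) = 0"
      unfolding Ad adjoint_conj_spectral_mat[OF U] using Bc i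
      by (auto simp: mat_diag_def simp del: index_mult_mat)
    moreover have "0 \<le> Re ((mat_adjoint U * B * U) $$ (i, i))"
      using psd_mat_diag_entry[OF _ psd_mat_conj[OF B U'c] i] Bc by simp
    ultimately show ?thesis using d[of i] by simp
  qed
  then have "mat_diag n (\<lambda>i. complex_of_real (d i)) = 0\<^sub>m n n"
    by (intro eq_matI) (auto simp: mat_diag_def)
  then show ?thesis unfolding Ad spectral_mat_def using Uc
    by (simp add: left_mult_zero_mat[of _ n n] right_mult_zero_mat[of _ n n])
qed

section \<open>Square roots and Moore-Penrose inverses\<close>

text \<open>With \<open>Z = R - Q\<close> one has \<open>Z R + Q Z = R R - Q Q = 0\<close>; in an eigenbasis of \<open>Z\<close> the diagonal
  of this equation reads \<open>z\<^sub>i (r\<^sub>i\<^sub>i + q\<^sub>i\<^sub>i) = 0\<close>, while \<open>z\<^sub>i = r\<^sub>i\<^sub>i - q\<^sub>i\<^sub>i\<close> with \<open>r\<^sub>i\<^sub>i\<close>, \<open>q\<^sub>i\<^sub>i\<close> non-negative.\<close>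
lemma psd_sqrt_unique:
  assumes R: "R \<in> carrier_mat n n" "psd_mat R" and Q: "Q \<in> carrier_mat n n" "psd_mat Q"
    and eq: "R * R = Q * Q"
  shows "R = Q"
proof -
  define Z where "Z = R - Q"
  have Z: "Z \<in> carrier_mat n n" unfolding Z_def using R Q by (simp add: minus_carrier_mat)
  have "hermitian_mat Z"
    unfolding Z_def hermitian_mat_def using R Q
    by (simp add: mat_adjoint_minus[of _ n n] psd_mat_def hermitian_mat_def)
  from hermitian_spectral[OF Z this] obtain U d where
    U: "unitary_mat n U" and Zd: "Z = spectral_mat n U d" .
  note Uc = unitary_carrier[OF U]
  have U'c: "mat_adjoint U \<in> carrier_mat n n" using Uc by simp
  have UU: "U * mat_adjoint U = 1\<^sub>m n" using U unfolding unitary_mat_def by simp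
  let ?c = "\<lambda>M. mat_adjoint U * M * U"
  have cc: "?c M \<in> carrier_mat n n" if "M \<in> carrier_mat n n" for M
    using that Uc U'c by (intro mult_carrier_mat)
  have cm: "?c M * ?c N = ?c (M * N)" if "M \<in> carrier_mat n n" "N \<in> carrier_mat n n" for M N
  proof -
    have "?c M * ?c N = mat_adjoint U * (M * ((U * mat_adjoint U) * (N * U)))"
      using that Uc by (simp add: assoc_mult_mat[of _ n n _ n _ n] mult_carrier_mat[of _ n n _ n])
    then show ?thesis
      unfolding UU using that Uc
      by (simp add: assoc_mult_mat[of _ n n _ n _ n] mult_carrier_mat[of _ n n _ n])
  qed
  have ca: "?c (M + N) = ?c M + ?c N" if "M \<in> carrier_mat n n" "N \<in> carrier_mat n n" for M N
    using that Uc
    by (simp add: mult_add_distrib_mat[of _ n n _ n] add_mult_distrib_mat[of _ n n _ _ n] mult_carrier_mat[of _ n n _ n])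
  have RZ: "R = Z + Q" unfolding Z_def using R Q by (intro eq_matI) auto
  have "Z * R + Q * Z = (R * R - Q * R) + (Q * R - Q * Q)"
    unfolding Z_def using R Q
    by (simp add: mult_minus_distrib_mat[of _ n n _ n] minus_mult_distrib_mat[of _ n n _ _ n])
  also have "\<dots> = 0\<^sub>m n n"
    unfolding eq using R Q by (intro eq_matI) (auto simp del: index_mult_mat(1))
  finally have "?c (Z * R + Q * Z) = 0\<^sub>m n n"
    using Uc by (simp add: left_mult_zero_mat[of _ n n])
  then have 0: "?c Z * ?c R + ?c Q * ?c Z = 0\<^sub>m n n"
    using Z R Q by (simp add: cm ca mult_carrier_mat[of _ n n _ n])
  have "d i = 0" if i: "i < n" for i
  proof -
    define r q where "r = ?c R $$ (i, i)" and "q = ?c Q $$ (i, i)"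
    have "(?c Z * ?c R + ?c Q * ?c Z) $$ (i, i) = of_real (d i) * r + q * of_real (d i)"
      unfolding Zd adjoint_conj_spectral_mat[OF U] r_def q_def
      using cc[OF R(1)] cc[OF Q(1)] i
      by (simp add: mat_diag_mult_left[of _ n n] mat_diag_mult_right[of _ n n] del: index_mult_mat(1))
    then have "of_real (d i) * r + q * of_real (d i) = 0" unfolding 0 using i by simp
    then have "d i * (Re r + Re q) = 0" by (auto simp: complex_eq_iff algebra_simps)
    moreover have "0 \<le> Re r" "0 \<le> Re q"
      using psd_mat_diag_entry[OF _ psd_mat_conj[OF R U'c] i] cc[OF R(1)]
        psd_mat_diag_entry[OF _ psd_mat_conj[OF Q U'c] i] cc[OF Q(1)]
      unfolding r_def q_def by (simp_all del: index_mult_mat(1))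
    moreover have "r = of_real (d i) + q"
    proof -
      have "r = (?c Z + ?c Q) $$ (i, i)" unfolding r_def using ca[OF Z Q(1)] RZ by simp
      also have "\<dots> = of_real (d i) + q"
        unfolding Zd adjoint_conj_spectral_mat[OF U] q_def using Uc Q(1) i
        by (simp add: mat_diag_def del: index_mult_mat(1))
      finally show ?thesis .
    qed
    then have "Re r = d i + Re q" by simp
    ultimately show ?thesis by (auto simp: add_nonneg_eq_0_iff)
  qed
  then have "mat_diag n (\<lambda>i. complex_of_real (d i)) = 0\<^sub>m n n"
    by (intro eq_matI) (auto simp: mat_diag_def)
  then have "Z = 0\<^sub>m n n" unfolding Zd spectral_mat_def using Uc
    by (simp add: left_mult_zero_mat[of _ n n] right_mult_zero_mat[of _ n n])
  then show ?thesis using RZ Q by simp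
qed

lemma psd_sqrt_eqI:
  assumes R: "R \<in> carrier_mat n n" "psd_mat R" and M: "R * R = M"
  shows "psd_sqrt M = R"
  unfolding psd_sqrt_def
proof (rule the_equality)
  fix Q assume Q: "psd_mat Q \<and> Q * Q = M"
  \<comment> \<open>The description behind \<open>psd_sqrt\<close> does not fix a dimension: a
    competitor \<open>Q\<close> is square because it is Hermitian, and its size is read off from
    \<open>Q * Q = M\<close>.\<close>
  have "Q \<in> carrier_mat (dim_row Q) (dim_row Q)"
    using Q hermitian_carrier unfolding psd_mat_def by blast
  moreover have "dim_row Q = n" using Q M R(1) by (metis carrier_matD(1) index_mult_mat(2))
  ultimately show "Q = R" using psd_sqrt_unique[of Q n R] Q R M by simp
qed (use assms in auto)

text \<open>Penrose's uniqueness argument. For a second solution \<open>Q\<close>, the product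
  \<open>M * P = (M * Q) * (M * P)\<close> is the adjoint of
  \<open>(M * P) * (M * Q) = M * Q\<close>, hence equals \<open>M * Q\<close>; likewise
  \<open>P * M = Q * M\<close>. Then
  \<open>Q = Q * M * Q = P * M * Q = P * M * P = P\<close>.\<close>

lemma mp_inverse_eqI:
  assumes M: "M \<in> carrier_mat n n" and P: "P \<in> carrier_mat n n"
    and eqs: "M * P * M = M" "P * M * P = P" "mat_adjoint (M * P) = M * P" "mat_adjoint (P * M) = P * M"
  shows "mp_inverse M = P"
  unfolding mp_inverse_def
proof (rule the_equality)
  fix Q assume "Q \<in> carrier_mat (dim_col M) (dim_row M) \<and> M * Q * M = M \<and> Q * M * Q = Q \<and>
    mat_adjoint (M * Q) = M * Q \<and> mat_adjoint (Q * M) = Q * M"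
  then have Q: "Q \<in> carrier_mat n n" and eqs': "M * Q * M = M" "Q * M * Q = Q"
    "mat_adjoint (M * Q) = M * Q" "mat_adjoint (Q * M) = Q * M" using M by auto
  note sq = assoc_mult_mat[of _ n n _ n _ n] mult_carrier_mat[of _ n n _ n]
  have c: "M * P \<in> carrier_mat n n" "M * Q \<in> carrier_mat n n"
    "P * M \<in> carrier_mat n n" "Q * M \<in> carrier_mat n n" using M P Q by auto
  have "M * P = (M * Q * M) * P" unfolding eqs' ..
  also have "\<dots> = (M * Q) * (M * P)" using M P Q by (simp add: sq)
  also have "\<dots> = mat_adjoint ((M * P) * (M * Q))"
    using mat_adjoint_mult[OF c(1,2)] eqs eqs' by simp
  also have "(M * P) * (M * Q) = (M * P * M) * Q" using M P Q by (simp add: sq)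
  also have "mat_adjoint ((M * P * M) * Q) = M * Q" unfolding eqs eqs' ..
  finally have MP: "M * P = M * Q" .
  have "P * M = P * (M * Q * M)" unfolding eqs' ..
  also have "\<dots> = (P * M) * (Q * M)" using M P Q by (simp add: sq)
  also have "\<dots> = mat_adjoint ((Q * M) * (P * M))"
    using mat_adjoint_mult[OF c(4,3)] eqs eqs' by simp
  also have "(Q * M) * (P * M) = Q * (M * P * M)" using M P Q by (simp add: sq)
  also have "mat_adjoint (Q * (M * P * M)) = Q * M" unfolding eqs eqs' ..
  finally have PM: "P * M = Q * M" .
  have "Q = (Q * M) * Q" using eqs' by simp
  also have "\<dots> = P * (M * Q)" unfolding PM[symmetric] using M P Q by (simp add: sq)
  also have "\<dots> = P * M * P" unfolding MP[symmetric] using M P Q by (simp add: sq)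
  finally show "Q = P" unfolding eqs .
qed (use assms in auto)

text \<open>With a Hermitian root \<open>R\<close> of \<open>A\<close> the sandwich is the Gram
  matrix of \<open>R * C\<close>, so \<open>R * C\<close> vanishes, and with it
  \<open>A * C = R * (R * C)\<close>.\<close>

lemma psd_sandwich_zero:
  assumes A: "A \<in> carrier_mat n n" "psd_mat A" and C: "C \<in> carrier_mat n n"
    and 0: "mat_adjoint C * A * C = 0\<^sub>m n n"
  shows "A * C = 0\<^sub>m n n"
proof -
  obtain U d where U: "unitary_mat n U" and Ad: "A = spectral_mat n U d" and d: "\<And>i. 0 \<le> d i"
    using psd_spectral[OF A] by blast
  define R where "R = spectral_mat n U (\<lambda>i. sqrt (d i))"
  have R: "R \<in> carrier_mat n n" "mat_adjoint R = R" "R * R = A"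
    unfolding R_def Ad
    using d by (simp_all add: spectral_mat_carrier[OF U] hermitian_spectral_mat[OF U] spectral_mat_mult[OF U])
  have "mat_adjoint (R * C) * (R * C) = mat_adjoint C * A * C"
    unfolding R(3)[symmetric] using R(1,2) C
    by (simp add: mat_adjoint_mult[of _ n n _ n] assoc_mult_mat[of _ n n _ n _ n] mult_carrier_mat[of _ n n _ n])
  then have "R * C = 0\<^sub>m n n" using gram_eq_zero[of "R * C" n] 0 R C by simp
  then have "R * (R * C) = 0\<^sub>m n n" using R by (simp add: right_mult_zero_mat[of _ n n])
  then show ?thesis using assoc_mult_eq[OF R(3) R(1) R(1) C] by simp
qed

text \<open>\<open>P\<close> is the orthogonal projection onto the range of \<open>S\<close>; the functional calculus applied to
  \<open>inverse\<close> yields the Moore-Penrose inverse because \<open>inverse 0 = 0\<close>.\<close>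
lemma psd_root_system:
  assumes S: "S \<in> carrier_mat n n" "psd_mat S"
  obtains T K P where "T \<in> carrier_mat n n" "K \<in> carrier_mat n n" "P \<in> carrier_mat n n"
    "mat_adjoint T = T" "mat_adjoint K = K" "mat_adjoint P = P" "psd_mat P"
    "T * T = S" "T * K = P" "K * T = P" "P * P = P" "P * T = T" "T * P = T" "P * K = K" "K * P = K"
    "psd_sqrt S = T" "mp_inverse S = K * K" "psd_sqrt (mp_inverse S) = K"
proof -
  obtain U d where U: "unitary_mat n U" and Sd: "S = spectral_mat n U d" and d: "\<And>i. 0 \<le> d i"
    using psd_spectral[OF S] by blast
  note [simp] = spectral_mat_carrier[OF U] hermitian_spectral_mat[OF U] spectral_mat_mult[OF U]
  define T where "T = spectral_mat n U (\<lambda>i. sqrt (d i))"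
  define K where "K = spectral_mat n U (\<lambda>i. inverse (sqrt (d i)))"
  define P where "P = spectral_mat n U (\<lambda>i. if d i = 0 then 0 else 1)"
  have psdT: "psd_mat T" and psdK: "psd_mat K"
    unfolding T_def K_def using d by (auto intro!: psd_spectral_mat[OF U])
  have psdP: "psd_mat P" unfolding P_def by (auto intro!: psd_spectral_mat[OF U])
  have S': "T * T = S" unfolding T_def Sd using d by simp
  have sP: "sqrt (d i) * inverse (sqrt (d i)) = (if d i = 0 then 0 else 1)"
    "inverse (sqrt (d i)) * sqrt (d i) = (if d i = 0 then 0 else 1)"
    "(if d i = 0 then 0 else 1) * (if d i = 0 then 0 else 1) = (if d i = 0 then 0 else (1 :: real))"
    "(if d i = 0 then 0 else 1) * sqrt (d i) = sqrt (d i)"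
    "sqrt (d i) * (if d i = 0 then 0 else 1) = sqrt (d i)"
    "(if d i = 0 then 0 else 1) * inverse (sqrt (d i)) = inverse (sqrt (d i))"
    "inverse (sqrt (d i)) * (if d i = 0 then 0 else 1) = inverse (sqrt (d i))" for i
    by auto
  have rels: "T * K = P" "K * T = P" "P * P = P" "P * T = T" "T * P = T" "P * K = K" "K * P = K"
    unfolding T_def K_def P_def by (simp_all only: spectral_mat_mult[OF U] sP)
  have mp: "mp_inverse S = K * K"
  proof (rule mp_inverse_eqI[OF S(1)])
    have [simp]: "d i * inverse (d i) * d i = d i" "inverse (d i) * d i * inverse (d i) = inverse (d i)" for i
      by (cases "d i = 0"; simp)+
    have KK: "K * K = spectral_mat n U (\<lambda>i. inverse (d i))"
      unfolding K_def using d by (simp flip: inverse_mult_distrib)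
    show "K * K \<in> carrier_mat n n" "S * (K * K) * S = S" "K * K * S * (K * K) = K * K"
      "mat_adjoint (S * (K * K)) = S * (K * K)" "mat_adjoint (K * K * S) = K * K * S"
      unfolding KK unfolding Sd by simp_all
  qed
  show ?thesis
  proof (rule that[of T K P])
    show "psd_sqrt S = T" "psd_sqrt (mp_inverse S) = K"
      using psd_sqrt_eqI[OF _ psdT S', of n] psd_sqrt_eqI[OF _ psdK mp[symmetric], of n]
      by (simp_all add: T_def K_def)
  qed (use psdP S' rels mp in \<open>simp_all add: T_def K_def P_def\<close>)
qed

text \<open>The range of \<open>X\<close> lies in that of \<open>X + Y\<close>. Compressing
  \<open>X + Y\<close> by \<open>Q = 1 - P\<close> gives zero, split into two positive semi-definite
  summands; thus \<open>Q * X * Q = 0\<close>, which forces \<open>X * Q = 0\<close>. Adjoints give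
  the second identity.\<close>

lemma psd_range_projection:
  assumes X: "X \<in> carrier_mat n n" "psd_mat X" and Y: "Y \<in> carrier_mat n n" "psd_mat Y"
    and P: "P \<in> carrier_mat n n" "mat_adjoint P = P" and SP: "(X + Y) * P = X + Y"
  shows "X * P = X" "P * X = X"
proof -
  define Q where "Q = 1\<^sub>m n - P"
  have Q: "Q \<in> carrier_mat n n" unfolding Q_def using P by (simp add: minus_carrier_mat)
  have hQ: "mat_adjoint Q = Q" unfolding Q_def using P by (simp add: mat_adjoint_minus[of _ n n])
  have "(X + Y) * Q = 0\<^sub>m n n"
    unfolding Q_def using X Y P SP
    by (simp add: mult_minus_distrib_mat[of _ n n _ n] right_mult_one_mat[of _ n n])
  then have "Q * ((X + Y) * Q) = 0\<^sub>m n n" using Q by (simp add: right_mult_zero_mat[of _ n n])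
  then have "Q * X * Q + Q * Y * Q = 0\<^sub>m n n"
    using X Y Q by (simp add: mult_add_distrib_mat[of _ n n _ n] add_mult_distrib_mat[of _ n n _ _ n]
        assoc_mult_mat[of _ n n _ n _ n] mult_carrier_mat[of _ n n _ n])
  moreover have "psd_mat (Q * X * Q)" "psd_mat (Q * Y * Q)"
    using psd_mat_conj[OF X Q] psd_mat_conj[OF Y Q] unfolding hQ .
  moreover have "Q * X * Q \<in> carrier_mat n n" "Q * Y * Q \<in> carrier_mat n n"
    using X Y Q by (simp_all add: mult_carrier_mat[of _ n n _ n])
  ultimately have "Q * X * Q = 0\<^sub>m n n"
    using psd_sum_eq_zero by blast
  then have "X * Q = 0\<^sub>m n n" using psd_sandwich_zero[OF X Q] hQ by simp
  then have "X - X * P = 0\<^sub>m n n"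
    unfolding Q_def using X P by (simp add: mult_minus_distrib_mat[of _ n n _ n] right_mult_one_mat[of _ n n])
  then show XP: "X * P = X"
    using mat_diff_eq_zeroD[of X "X * P" n] X P by simp
  show "P * X = X"
    using arg_cong[OF XP, of mat_adjoint] X P mat_adjoint_psd[OF X(2)]
    by (simp add: mat_adjoint_mult[of _ n n _ n])
qed

text \<open>\<open>R\<close> is the absolute value of \<open>F\<close>: each eigenvalue is replaced
  by its modulus, which dominates both the eigenvalue and its negative.\<close>

lemma psd_abs_exists:
  assumes F: "F \<in> carrier_mat n n" "hermitian_mat F"
  obtains R where "R \<in> carrier_mat n n" "psd_mat R" "R * R = F * F" "psd_mat (R - F)" "psd_mat (R + F)"
proof -
  obtain U d where U: "unitary_mat n U" and Fd: "F = spectral_mat n U d"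
    using hermitian_spectral[OF F] .
  show ?thesis
  proof (rule that[of "spectral_mat n U (\<lambda>i. \<bar>d i\<bar>)"])
  qed (auto simp: Fd spectral_mat_carrier[OF U] spectral_mat_mult[OF U] spectral_mat_add[OF U]
      spectral_mat_minus[OF U] intro!: psd_spectral_mat[OF U])
qed

section \<open>The upper bound\<close>

theorem theorem2p4:
  fixes X Y :: "complex mat" and n :: nat
  assumes "X \<in> carrier_mat n n" and "Y \<in> carrier_mat n n"
    and "psd_mat X" and "psd_mat Y"
  shows "psd_mat (X + Y - 4 \<cdot>\<^sub>m parallel_sum X Y)
    \<and> X \<le>\<^sub>L mat_join X Y \<and> Y \<le>\<^sub>L mat_join X Y
    \<and> mat_join X Y \<le>\<^sub>L upper_C X Y
    \<and> (mat_join X Y = upper_C X Y \<longleftrightarrow> parallel_sum X Y = 0\<^sub>m n n)"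
proof -
  note X = assms(1,3) and Y = assms(2,4)
  note hX = mat_adjoint_psd[OF X(2)] and hY = mat_adjoint_psd[OF Y(2)]
  note mc = mult_carrier_mat[of _ n n _ n] minus_carrier_mat[of _ n n]
  note assoc = assoc_mult_mat[of _ n n _ n _ n] mc
  note dist = mult_add_distrib_mat[of _ n n _ n] add_mult_distrib_mat[of _ n n _ _ n]
    mult_minus_distrib_mat[of _ n n _ n] minus_mult_distrib_mat[of _ n n _ _ n]
    mult_smult_distrib[of _ n n _ n] mult_smult_assoc_mat[of _ n n _ n] smult_smult_mat

  \<comment> \<open>The sum, its roots and its range projection\<close>
  define S D where "S = X + Y" and "D = X - Y"
  have S: "S \<in> carrier_mat n n" "psd_mat S"
    unfolding S_def using X Y psd_mat_add[OF X Y] by simp_all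
  have D: "D \<in> carrier_mat n n" and hD: "mat_adjoint D = D"
    unfolding D_def using X Y hX hY by (simp_all add: minus_carrier_mat mat_adjoint_minus[of _ n n])
  obtain T K P where T: "T \<in> carrier_mat n n" and K: "K \<in> carrier_mat n n" and P: "P \<in> carrier_mat n n"
    and h: "mat_adjoint T = T" "mat_adjoint K = K" "mat_adjoint P = P" "psd_mat P"
    and TT: "T * T = S" and TK: "T * K = P" and KT: "K * T = P" and PP: "P * P = P"
    and PT: "P * T = T" and TP: "T * P = T" and PK: "P * K = K" and KP: "K * P = K"
    and sqrtS: "psd_sqrt S = T" and mpS: "mp_inverse S = K * K" and sqrtK: "psd_sqrt (mp_inverse S) = K"
    using psd_root_system[OF S] .
  have SP: "S * P = S" "P * S = S"
    unfolding TT[symmetric] using T P TP assoc_mult_eq[OF PT P T T] by (simp_all add: assoc)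
  have XP: "X * P = X" "P * X = X"
    using psd_range_projection[OF X Y P h(3)] SP unfolding S_def by simp_all
  have "Y + X = S" unfolding S_def by (rule comm_add_mat[OF Y(1) X(1)])
  then have YP: "Y * P = Y" "P * Y = Y"
    using psd_range_projection[OF Y X P h(3)] SP by simp_all
  have DP: "D * P = D" "P * D = D"
    unfolding D_def using X Y P XP YP by (simp_all add: dist)

  \<comment> \<open>The parallel sum and the first assertion\<close>
  define G where "G = K * K"
  have G: "G \<in> carrier_mat n n" and hG: "mat_adjoint G = G"
    unfolding G_def using K h by (simp_all add: mat_adjoint_mult[of _ n n _ n] mc)
  define N where "N = X * G * Y"
  have N: "N \<in> carrier_mat n n" unfolding N_def using X Y G by (simp add: mc)
  have psumN: "parallel_sum X Y = N"
    unfolding parallel_sum_def S_def[symmetric] mpS N_def G_def ..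
  have "S * G = T * (T * (K * K))" unfolding TT[symmetric] G_def using T K by (simp add: assoc)
  also have "\<dots> = P" using assoc_mult_eq[OF TK T K K] PK TK by simp
  finally have SG: "S * G = P" .
  have "G * S = mat_adjoint (S * G)"
    using S G hG mat_adjoint_psd[OF S(2)] by (simp add: mat_adjoint_mult[of _ n n _ n])
  then have GS: "G * S = P" unfolding SG using h by simp
  \<comment> \<open>Splitting the factor \<open>S\<close> as \<open>X + Y\<close> in
    \<open>X * G * S = X\<close>, \<open>S * G * Y = Y\<close> and \<open>Y * G * S = Y\<close>
    expresses all four products of \<open>X\<close>, \<open>Y\<close> around \<open>G\<close> by
    \<open>N\<close>. In particular \<open>Y * G * X = N\<close>, so the parallel sum is symmetric
    in its arguments and therefore Hermitian.\<close>
  have sum1: "X * G * X + N = X * (G * S)"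
    unfolding S_def N_def using X Y G by (simp add: dist assoc)
  have XGX: "X * G * X = X - N"
    using mat_diff_eqI[OF sum1[unfolded GS XP] _ N] X G by (simp add: mc)
  have sum2: "Y * G * Y + N = S * G * Y"
    unfolding S_def N_def using X Y G comm_add_mat[of "Y * G * Y" n n "X * G * Y"]
    by (simp add: dist assoc)
  have YGY: "Y * G * Y = Y - N"
    using mat_diff_eqI[OF sum2[unfolded SG YP] _ N] Y G by (simp add: mc)
  have sum3: "Y * G * X + Y * G * Y = Y * (G * S)"
    unfolding S_def using X Y G by (simp add: dist assoc)
  have Y_N: "Y - (Y - N) = N" "Y - N \<in> carrier_mat n n"
    using Y N by (auto intro!: eq_matI simp: minus_carrier_mat)
  have YGX: "Y * G * X = N"
    using mat_diff_eqI[OF sum3[unfolded GS YP YGY] _ Y_N(2)] X Y G Y_N(1) by (simp add: mc)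
  have hN: "mat_adjoint N = N"
  proof -
    have "mat_adjoint N = Y * G * X"
      unfolding N_def using X Y G hX hY hG by (simp add: mat_adjoint_mult[of _ n n _ n] assoc)
    then show ?thesis unfolding YGX .
  qed
  \<comment> \<open>The four products contribute \<open>X - N\<close>, \<open>-N\<close>,
    \<open>-N\<close> and \<open>Y - N\<close>.\<close>
  have "D * G * D = (X * G * X - Y * G * X) - (X * G * Y - Y * G * Y)"
    unfolding D_def using X Y G by (simp add: dist mc)
  also have "\<dots> = S - 4 \<cdot>\<^sub>m N"
    unfolding XGX YGX YGY N_def[symmetric] S_def using X Y N by (intro eq_matI) auto
  finally have DGD: "D * G * D = S - 4 \<cdot>\<^sub>m N" .
  have "mat_adjoint (K * D) * (K * D) = D * G * D"
    unfolding G_def using K D h hD by (simp add: mat_adjoint_mult[of _ n n _ n] assoc)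
  then have psd1: "psd_mat (S - 4 \<cdot>\<^sub>m N)"
    using psd_mat_gram[of "K * D" n] K D unfolding DGD by (simp add: mc)

  \<comment> \<open>The square root of W as an absolute value\<close>
  define F where "F = (1/2) \<cdot>\<^sub>m (K * D * K)"
  have F: "F \<in> carrier_mat n n" unfolding F_def using K D by (simp add: mc)
  have hF: "hermitian_mat F"
    unfolding F_def hermitian_mat_def using K D h hD
    by (simp add: mat_adjoint_smult mat_adjoint_mult[of _ n n _ n] assoc)
  define Q where "Q = (1/4) \<cdot>\<^sub>m S - N"
  have Q: "Q \<in> carrier_mat n n" unfolding Q_def using S N by (simp add: minus_carrier_mat)
  have QD: "Q = (1/4) \<cdot>\<^sub>m (D * G * D)"
    unfolding Q_def DGD using S N by (intro eq_matI) (auto simp: field_simps)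
  define W where "W = K * Q * K"
  have W: "W \<in> carrier_mat n n" unfolding W_def using K Q by (simp add: mc)
  have joinW: "join_W X Y = W"
    unfolding join_W_def S_def[symmetric] sqrtK psumN Q_def[symmetric] W_def ..
  have "F * F = (1/4) \<cdot>\<^sub>m (K * D * K * (K * D * K))"
    unfolding F_def using K D by (simp add: dist mc)
  then have FF: "F * F = W"
    unfolding W_def QD G_def using K D by (simp add: dist assoc)
  \<comment> \<open>Among the roots of \<open>W = F * F\<close> the absolute value of
    \<open>F\<close> is taken, since it also dominates \<open>F\<close> and its negative; by
    uniqueness it is the root that occurs in the join.\<close>
  obtain R where R: "R \<in> carrier_mat n n" "psd_mat R" and RR: "R * R = W"
    and R_F: "psd_mat (R - F)" "psd_mat (R + F)"
    using psd_abs_exists[OF F hF] unfolding FF .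
  note hR = mat_adjoint_psd[OF R(2)]
  have sqrtW: "psd_sqrt W = R" by (rule psd_sqrt_eqI[OF R RR])

  \<comment> \<open>The join is a common upper bound\<close>
  have TKD: "T * (K * (D * (K * T))) = D"
    using assoc_mult_eq[OF TK T K, of "D * (K * T)"] D K T P DP unfolding KT by (simp add: mc)
  have TFT: "T * F * T = (1/2) \<cdot>\<^sub>m D"
    unfolding F_def using T K D TKD by (simp add: dist assoc)
  define M where "M = T * R * T"
  have M: "M \<in> carrier_mat n n" unfolding M_def using T R by (simp add: mc)
  have hM: "mat_adjoint M = M"
    unfolding M_def using T R h hR by (simp add: mat_adjoint_mult[of _ n n _ n] assoc)
  define J where "J = (1/2) \<cdot>\<^sub>m S + M"
  have J: "J \<in> carrier_mat n n" unfolding J_def using S M by simp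
  have hJ: "mat_adjoint J = J"
    unfolding J_def using S M hM mat_adjoint_psd[OF S(2)]
    by (simp add: mat_adjoint_add[of _ n n] mat_adjoint_smult)
  have join: "mat_join X Y = J"
    unfolding mat_join_def S_def[symmetric] sqrtS joinW sqrtW J_def M_def ..
  \<comment> \<open>Half of \<open>S\<close> differs from \<open>X\<close> by minus half of
    \<open>D\<close>, and from \<open>Y\<close> by plus half of \<open>D\<close>; since half of
    \<open>D\<close> is \<open>T * F * T\<close>, both differences become conjugates by
    \<open>T\<close>.\<close>
  have "J - X = M - (1/2) \<cdot>\<^sub>m D"
    unfolding J_def S_def D_def using X Y M by (intro eq_matI) (auto simp: field_simps)
  also have "\<dots> = T * (R - F) * mat_adjoint T"
    unfolding TFT[symmetric] M_def h using T R F by (simp add: dist mc)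
  finally have JX: "psd_mat (J - X)"
    using psd_mat_conj[OF _ R_F(1) T] R F by (simp add: minus_carrier_mat)
  have "J - Y = M + (1/2) \<cdot>\<^sub>m D"
    unfolding J_def S_def D_def using X Y M by (intro eq_matI) (auto simp: field_simps)
  also have "\<dots> = T * (R + F) * mat_adjoint T"
    unfolding TFT[symmetric] M_def h using T R F by (simp add: dist mc)
  finally have JY: "psd_mat (J - Y)"
    using psd_mat_conj[OF _ R_F(2) T] R F by simp

  \<comment> \<open>Support of the root and recovery of Q from W\<close>
  have WP: "W * P = W"
    unfolding W_def using K Q P KP by (simp add: assoc)
  define Z where "Z = 1\<^sub>m n - P"
  have Z: "Z \<in> carrier_mat n n" and hZ: "mat_adjoint Z = Z"
    unfolding Z_def using P h by (simp_all add: minus_carrier_mat mat_adjoint_minus[of _ n n])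
  have WZ: "W * Z = 0\<^sub>m n n"
    unfolding Z_def using W P WP by (simp add: dist right_mult_one_mat[of _ n n])
  \<comment> \<open>The kernel of \<open>W = R * R\<close> is inherited by \<open>R\<close>: the
    Gram matrix of \<open>R * Z\<close> is \<open>Z * W * Z\<close>, which vanishes.\<close>
  have "mat_adjoint (R * Z) * (R * Z) = Z * (R * (R * Z))"
    using R Z hR hZ by (simp add: mat_adjoint_mult[of _ n n _ n] assoc)
  also have "\<dots> = 0\<^sub>m n n"
    using assoc_mult_eq[OF RR R(1) R(1) Z] WZ Z by (simp add: right_mult_zero_mat[of _ n n])
  finally have "R * Z = 0\<^sub>m n n" using gram_eq_zero[of "R * Z" n] R Z by (simp add: mc)
  then have RP0: "R - R * P = 0\<^sub>m n n"
    unfolding Z_def using R P by (simp add: dist right_mult_one_mat[of _ n n])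
  have RP: "R * P = R" using mat_diff_eq_zeroD[OF RP0 R(1)] R P by simp
  have PR: "P * R = R"
    using arg_cong[OF RP, of mat_adjoint] R P h hR by (simp add: mat_adjoint_mult[of _ n n _ n])

  \<comment> \<open>\<open>P\<close> fixes \<open>S\<close> and \<open>N\<close> from both sides.
    Hence conjugation by \<open>T\<close> undoes the conjugation by \<open>K\<close> in
    \<open>W\<close> and returns \<open>Q\<close>.\<close>
  have GT: "P * Q * P = Q"
    unfolding Q_def N_def using S P SP X Y G XP YP assoc_mult_eq[OF XP(2) P X(1)]
    by (simp add: dist assoc)
  have TWT: "T * W * T = Q"
  proof -
    have "T * W * T = (T * K) * Q * (K * T)"
      unfolding W_def using T K Q by (simp add: assoc)
    then show ?thesis unfolding TK KT GT .
  qed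

  \<comment> \<open>The gap to the upper bound and the case of equality\<close>
  define E where "E = (1/2) \<cdot>\<^sub>m P - R"
  have E: "E \<in> carrier_mat n n" and hE: "mat_adjoint E = E"
    unfolding E_def using P R h hR
    by (simp_all add: minus_carrier_mat mat_adjoint_minus[of _ n n] mat_adjoint_smult)
  \<comment> \<open>Because \<open>P * R = R * P = R\<close>, the two cross terms together
    contribute exactly one \<open>-R\<close>.\<close>
  have EE: "E * E = (1/4) \<cdot>\<^sub>m P + W - R"
  proof -
    have "E * E = (1/2) \<cdot>\<^sub>m ((1/2) \<cdot>\<^sub>m P - R) - ((1/2) \<cdot>\<^sub>m R - W)"
      unfolding E_def using P R by (simp add: dist mc PP PR RP RR)
    also have "\<dots> = (1/4) \<cdot>\<^sub>m P + W - R"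
      using P R W by (intro eq_matI) (auto simp: field_simps)
    finally show ?thesis .
  qed
  have TPT: "T * P * T = S" using TP TT by simp
  define C where "C = upper_C X Y"
  have CN: "C = S - N" unfolding C_def upper_C_def psumN S_def ..
  have Cc: "C \<in> carrier_mat n n" and hC: "mat_adjoint C = C"
    unfolding CN using S N hN mat_adjoint_psd[OF S(2)]
    by (simp_all add: minus_carrier_mat mat_adjoint_minus[of _ n n])
  have CJ: "C - J = mat_adjoint (E * T) * (E * T)"
  proof -
    have "mat_adjoint (E * T) * (E * T) = T * (E * E) * T"
      using E T hE h by (simp add: mat_adjoint_mult[of _ n n _ n] assoc)
    also have "\<dots> = (1/4) \<cdot>\<^sub>m (T * P * T) + T * W * T - M"
      unfolding EE M_def using T P W R by (simp add: dist mc)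
    \<comment> \<open>A quarter of \<open>S\<close> plus \<open>Q\<close> is half of
      \<open>S\<close> minus \<open>N\<close>; subtracting \<open>M\<close> leaves
      \<open>S - N\<close> minus the join.\<close>
    also have "\<dots> = C - J"
      unfolding TPT TWT CN J_def Q_def using S M N by (intro eq_matI) (auto simp: field_simps)
    finally show ?thesis ..
  qed
  have "J = C \<longleftrightarrow> N = 0\<^sub>m n n"
  proof
    assume "J = C"
    then have "mat_adjoint (E * T) * (E * T) = 0\<^sub>m n n"
      using CJ Cc by (simp add: minus_r_inv_mat[of _ n n])
    then have "E * T = 0\<^sub>m n n" using gram_eq_zero[of "E * T" n] E T by (simp add: mc)
    \<comment> \<open>Multiplication by \<open>K\<close> replaces \<open>T\<close> by the projection
      \<open>P\<close>, which leaves \<open>E\<close> unchanged, so \<open>E\<close> itself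
      vanishes.\<close>
    then have "E * T * K = 0\<^sub>m n n" using K by simp
    then have "E * P = 0\<^sub>m n n" using E T K TK by (simp add: assoc)
    then have "(1/2) \<cdot>\<^sub>m P - R = 0\<^sub>m n n"
      unfolding E_def using P R by (simp add: dist mc PP RP)
    from mat_diff_eq_zeroD[OF this] have Rhalf: "R = (1/2) \<cdot>\<^sub>m P" using P R by simp
    have "W = (1/4) \<cdot>\<^sub>m P"
      unfolding RR[symmetric] Rhalf using P by (simp add: dist mc PP)
    then have "Q = (1/4) \<cdot>\<^sub>m (T * P * T)"
      unfolding TWT[symmetric] using T P by (simp add: dist mc)
    then have Q4: "Q = (1/4) \<cdot>\<^sub>m S" unfolding TPT .
    have "N = (1/4) \<cdot>\<^sub>m S - Q" unfolding Q_def using S N by (intro eq_matI) auto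
    then show "N = 0\<^sub>m n n" unfolding Q4 using S by (auto intro!: eq_matI)
  next
    assume N0: "N = 0\<^sub>m n n"
    have "Q = (1/4) \<cdot>\<^sub>m S" unfolding Q_def N0 using S by (intro eq_matI) auto
    then have "W = (1/4) \<cdot>\<^sub>m (K * S * K)" unfolding W_def using K S by (simp add: dist mc)
    also have "K * S * K = (K * T) * (T * K)"
      unfolding TT[symmetric] using K T by (simp add: assoc)
    also have "\<dots> = P" unfolding TK KT PP ..
    finally have WPq: "W = (1/4) \<cdot>\<^sub>m P" .
    \<comment> \<open>\<open>P\<close> is idempotent, so half of \<open>P\<close> is a positive
      semi-definite root of \<open>W\<close>; uniqueness identifies it with
      \<open>R\<close>.\<close>
    have "psd_mat ((1/2) \<cdot>\<^sub>m P)" using psd_mat_smult[OF P h(4), of "1/2"] by simp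
    moreover have "((1/2) \<cdot>\<^sub>m P) * ((1/2) \<cdot>\<^sub>m P) = W"
      unfolding WPq using P PP by (simp add: dist mc)
    ultimately have "R = (1/2) \<cdot>\<^sub>m P"
      using psd_sqrt_unique[OF R] RR P by simp
    then have "E = 0\<^sub>m n n" unfolding E_def using P by (simp add: minus_r_inv_mat[of _ n n])
    then have "C - J = 0\<^sub>m n n" unfolding CJ using T by simp
    from mat_diff_eq_zeroD[OF this Cc J] show "J = C" ..
  qed
  moreover have "psd_mat (C - J)"
    unfolding CJ using psd_mat_gram[of "E * T" n] E T by (simp add: mc)
  ultimately show ?thesis
    using psd1 JX JY X Y J Cc hJ hC unfolding join psumN C_def[symmetric] S_def[symmetric]
    by (auto simp: loewner_le_def hermitian_mat_def psd_mat_def)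
qed

end
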